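(* Let $M\in\mathbb{N}$ and let $\mathcal{P}_i=(F_i,G,S_i,K_i,\Lambda_i)$ $(i=1,\dots,M)$ be numerical problems with the same Banach space $G$, such that for each $i$ no element of $\Lambda_i$ is constant on $F_i$. Let $\mathcal{P}=(F,G,S,K,\Lambda)$ be the sum problem, let $\mu_i$ be probability measures on $F_i$ with finite support, let $\nu_i\ge0$ be reals with $\sum_{i=1}^M\nu_i=1$, let for each $i$ elements $f_{i,j,0}\in F_j$ $(1\le j\le M,\ j\ne i)$ be fixed with $$\sum_{1\le j\le M,\,j\ne i}S_j(f_{i,j,0})=0,$$ and let $\mu$ be the resulting measure on $F$ (sum problem and $\mu$ as defined in the context). Then for each $n\in\mathbb{N}_0$ $$e_n^{\mathrm{avg-non}}(S,\mu,G)\ge\min\Big\{\sum_{i=1}^M\nu_i\,e_{n_i}^{\mathrm{avg-non}}(S_i,\mu_i,G):\ n_i\in\mathbb{N}_0,\ \sum_{i=1}^Mn_i\le n\Big\}.$$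
   Context: $\mathbb{N}=\{1,2,\dots\}$, $\mathbb{N}_0=\mathbb{N}\cup\{0\}$. A numerical problem is a tuple $(F,G,S,K,\Lambda)$: $F$ a nonempty set, $G$ a Banach space, $S:F\to G$ a map, $K$ a nonempty set, $\Lambda$ a nonempty set of maps $F\to K$. Sum problem: $F=\prod_{i=1}^MF_i$, $S(f_1,\dots,f_M)=\sum_{i=1}^MS_i(f_i)$, $K=\bigcup_{i=1}^MK_i$, $\Lambda=\bigcup_{i=1}^M\Phi_i(\Lambda_i)$, where $\Phi_i(\lambda_i):F\to K$ is given by $(\Phi_i(\lambda_i))(f_1,\dots,f_M)=\lambda_i(f_i)$. Measure $\mu$: let $J_i:F_i\to F$ be the map sending $f_i$ to the tuple whose $i$-th component is $f_i$ and whose $j$-th component is $f_{i,j,0}$ for $j\ne i$. For $C\subseteq F$, $\mu(C)=\sum_{i=1}^M\nu_i\,\mu_i(J_i^{-1}(C))$. Non-adaptive average minimal errors: a non-adaptive deterministic algorithm $A$ using $m\in\mathbb{N}_0$ information functionals is given by $\lambda_1,\dots,\lambda_m\in\Lambda$ and a map $\varphi:K^m\to G$ (an element of $G$ if $m=0$), with output $A(f)=\varphi(\lambda_1(f),\dots,\lambda_m(f))$. For a probability measure $\mu$ on $F$ with finite support, $e_n^{\mathrm{avg-non}}(S,\mu,G)$ is the infimum of $\int_F\|S(f)-A(f)\|_G\,d\mu(f)$ over all non-adaptive deterministic algorithms $A$ using at most $n$ information functionals. *)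

theory Defs
  imports "HOL-Probability.Probability"
begin

(* The target space G of a problem is the Banach space UNIV :: 'g set.  Maps on F are
   total HOL functions of which only the values on F matter. *)

record ('f, 'k, 'g) problem =
  inputs :: "'f set"               (* F *)
  sol :: "'f \<Rightarrow> 'g"                (* S *)
  infovals :: "'k set"             (* K *)
  infos :: "('f \<Rightarrow> 'k) set"        (* \<Lambda> *)

definition numerical_problem :: "('f, 'k, 'g::banach) problem \<Rightarrow> bool" where
  "numerical_problem P \<longleftrightarrow>
     inputs P \<noteq> {} \<and> infovals P \<noteq> {} \<and> infos P \<noteq> {} \<and> infos P \<subseteq> inputs P \<rightarrow> infovals P"

(* Problems with index set {1..M}; the inputs F_i of all problems are subsets of one type,
   and likewise the K_i, which may overlap. *)

definition info_lift :: "nat \<Rightarrow> ('f \<Rightarrow> 'k) \<Rightarrow> (nat \<Rightarrow> 'f) \<Rightarrow> 'k" where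
  "info_lift i l = (\<lambda>f. l (f i))"

definition sum_problem ::
  "nat \<Rightarrow> (nat \<Rightarrow> ('f, 'k, 'g::banach) problem) \<Rightarrow> (nat \<Rightarrow> 'f, 'k, 'g) problem" where
  "sum_problem M P =
     \<lparr>inputs = (\<Pi>\<^sub>E i\<in>{1..M}. inputs (P i)),
      sol = (\<lambda>f. \<Sum>i=1..M. sol (P i) (f i)),
      infovals = (\<Union>i\<in>{1..M}. infovals (P i)),
      infos = (\<Union>i\<in>{1..M}. info_lift i ` infos (P i))\<rparr>"

definition fin_supp_prob :: "'f set \<Rightarrow> 'f measure \<Rightarrow> bool" where
  "fin_supp_prob F \<mu> \<longleftrightarrow>
     prob_space \<mu> \<and> space \<mu> = F \<and> sets \<mu> = Pow F \<and>
     (\<exists>A. finite A \<and> A \<subseteq> F \<and> emeasure \<mu> A = 1)"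

definition embed :: "nat \<Rightarrow> (nat \<Rightarrow> nat \<Rightarrow> 'f) \<Rightarrow> nat \<Rightarrow> 'f \<Rightarrow> nat \<Rightarrow> 'f" where
  "embed M f0 i x = (\<lambda>j\<in>{1..M}. if j = i then x else f0 i j)"

definition sum_measure ::
  "nat \<Rightarrow> (nat \<Rightarrow> 'f set) \<Rightarrow> (nat \<Rightarrow> 'f measure) \<Rightarrow> (nat \<Rightarrow> real) \<Rightarrow> (nat \<Rightarrow> nat \<Rightarrow> 'f)
     \<Rightarrow> (nat \<Rightarrow> 'f) measure" where
  "sum_measure M F \<mu> \<nu> f0 =
     measure_of (\<Pi>\<^sub>E i\<in>{1..M}. F i) (Pow (\<Pi>\<^sub>E i\<in>{1..M}. F i))
       (\<lambda>C. \<Sum>i=1..M. ennreal (\<nu> i) * emeasure (\<mu> i) (embed M f0 i -` C \<inter> F i))"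

(* measure_of silently yields the null measure if its argument is not a measure;
   this lemma rules that out. *)

lemma emeasure_sum_measure:
  assumes \<mu>: "\<And>i. i \<in> {1..M} \<Longrightarrow> fin_supp_prob (F i) (\<mu> i)"
    and C: "C \<subseteq> (\<Pi>\<^sub>E i\<in>{1..M}. F i)"
  shows "emeasure (sum_measure M F \<mu> \<nu> f0) C =
    (\<Sum>i=1..M. ennreal (\<nu> i) * emeasure (\<mu> i) (embed M f0 i -` C \<inter> F i))"
  unfolding sum_measure_def
proof (rule emeasure_measure_of_sigma)
  let ?F = "\<Pi>\<^sub>E i\<in>{1..M}. F i"
  let ?m = "\<lambda>C. \<Sum>i=1..M. ennreal (\<nu> i) * emeasure (\<mu> i) (embed M f0 i -` C \<inter> F i)"
  show "sigma_algebra ?F (Pow ?F)" by (rule sigma_algebra_Pow)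
  show "positive (Pow ?F) ?m" by (simp add: positive_def)
  show "countably_additive (Pow ?F) ?m"
  proof (rule countably_additiveI)
    fix A :: "nat \<Rightarrow> (nat \<Rightarrow> 'a) set"
    assume A: "disjoint_family A"
    have *: "(\<Sum>n. emeasure (\<mu> i) (embed M f0 i -` A n \<inter> F i)) =
        emeasure (\<mu> i) (embed M f0 i -` (\<Union>n. A n) \<inter> F i)" if i: "i \<in> {1..M}" for i
    proof -
      have "(\<Sum>n. emeasure (\<mu> i) (embed M f0 i -` A n \<inter> F i)) =
          emeasure (\<mu> i) (\<Union>n. embed M f0 i -` A n \<inter> F i)"
        using \<mu>[OF i] A by (intro suminf_emeasure) (auto simp: fin_supp_prob_def disjoint_family_on_def)
      also have "(\<Union>n. embed M f0 i -` A n \<inter> F i) = embed M f0 i -` (\<Union>n. A n) \<inter> F i"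
        by auto
      finally show ?thesis .
    qed
    have "(\<Sum>n. ?m (A n)) =
        (\<Sum>i=1..M. \<Sum>n. ennreal (\<nu> i) * emeasure (\<mu> i) (embed M f0 i -` A n \<inter> F i))"
      by (rule suminf_sum) simp
    also have "\<dots> = ?m (\<Union>n. A n)"
      by (rule sum.cong) (simp_all add: *)
    finally show "(\<Sum>n. ?m (A n)) = ?m (\<Union>n. A n)" .
  qed
  show "C \<in> Pow ?F" using C by simp
qed

(* A non-adaptive algorithm is a list ls of m elements of \<Lambda> with a map \<phi> on value lists
   (K^m = lists of length m; for m = 0, \<phi> [] is the element of G). *)

definition alg_output :: "('f \<Rightarrow> 'k) list \<Rightarrow> ('k list \<Rightarrow> 'g) \<Rightarrow> 'f \<Rightarrow> 'g" where
  "alg_output ls \<phi> f = \<phi> (map (\<lambda>l. l f) ls)"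

definition avg_non_error :: "nat \<Rightarrow> ('f, 'k, 'g::banach) problem \<Rightarrow> 'f measure \<Rightarrow> real" where
  "avg_non_error n P \<mu> =
     Inf {\<integral>f. norm (sol P f - alg_output ls \<phi> f) \<partial>\<mu> | ls \<phi>. set ls \<subseteq> infos P \<and> length ls \<le> n}"

end

theory Submission imports Defs begin

text \<open>
  Run an algorithm for the sum problem on the slice of inputs that \<mu> sees through its
  \<open>i\<close>-th part, namely on the points \<open>embed M f0 i x\<close>. A functional lifted from a problem
  \<open>j \<noteq> i\<close> returns a value that does not depend on \<open>x\<close>, so on this slice the algorithm
  is an algorithm for problem \<open>i\<close> alone, whose information consists of the functionals lifted
  from that problem (\<open>alg_output_factor\<close>). The solution on the slice is also that of problem
  \<open>i\<close>, because the components \<open>f0 i j\<close> are chosen such that their solutions cancel.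

  If the \<open>i\<close>-th problem owns \<open>k i\<close> of the functionals, the \<open>k i\<close> add up to the number of
  functionals used. The average error is the convex combination of the average errors on the slices
  (\<open>integral_sum_measure\<close>), hence at least the combination of the \<open>k i\<close>-th minimal errors.
  Taking the infimum over all algorithms gives the bound.
\<close>

lemma integral_finite_support:
  fixes h :: "'a \<Rightarrow> real"
  assumes "sets N = Pow (space N)" "finite A" "A \<subseteq> space N"
    and null: "emeasure N (space N - A) = 0"
    and fin: "\<And>a. a \<in> A \<Longrightarrow> emeasure N {a} < \<infinity>"
  shows "integral\<^sup>L N h = (\<Sum>a\<in>A. measure N {a} * h a)"
proof -
  have "integral\<^sup>L N h = integral\<^sup>L N (\<lambda>x. \<Sum>a\<in>A. indicator {a} x * h a)"
  proof (rule integral_cong_AE)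
    show "AE x in N. h x = (\<Sum>a\<in>A. indicator {a} x * h a)"
    proof (rule AE_I)
      show "{x \<in> space N. \<not> h x = (\<Sum>a\<in>A. indicator {a} x * h a)} \<subseteq> space N - A"
        using assms(2) by (auto simp: indicator_def sum.delta' if_distrib cong: if_cong)
      show "emeasure N (space N - A) = 0" by (rule null)
      show "space N - A \<in> sets N" using assms(1) by auto
    qed
  qed (auto simp: measurable_def assms(1))
  also have "\<dots> = (\<Sum>a\<in>A. measure N {a} * h a)"
  proof (subst Bochner_Integration.integral_sum)
    show "integrable N (\<lambda>x. indicator {a} x * h a)" if "a \<in> A" for a
      using that assms(1,3) fin by (auto intro!: integrable_mult_left integrable_real_indicator)
    show "(\<Sum>a\<in>A. \<integral>x. indicator {a} x * h a \<partial>N) = (\<Sum>a\<in>A. measure N {a} * h a)"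
      using assms(3) by (intro sum.cong) (auto simp: Int_absorb1 Int_absorb2)
  qed
  finally show ?thesis .
qed

lemma embed_mem:
  assumes "i \<in> {1..M}" "x \<in> F i" "\<And>j. j \<in> {1..M} - {i} \<Longrightarrow> f0 i j \<in> F j"
  shows "embed M f0 i x \<in> (\<Pi>\<^sub>E j\<in>{1..M}. F j)"
  using assms by (auto simp: embed_def)

text \<open>
  The sum measure is the mixture, with weights \<open>\<nu> i\<close>, of the images of the \<open>\<mu> i\<close> under the
  embeddings. All these measures live on one common finite set of points, over which both sides can
  be written out as finite sums.
\<close>

lemma integral_sum_measure:
  fixes h :: "(nat \<Rightarrow> 'f) \<Rightarrow> real"
  assumes \<mu>: "\<And>i. i \<in> {1..M} \<Longrightarrow> fin_supp_prob (F i) (\<mu> i)"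
    and \<nu>: "\<And>i. i \<in> {1..M} \<Longrightarrow> \<nu> i \<ge> 0"
    and f0: "\<And>i j. i \<in> {1..M} \<Longrightarrow> j \<in> {1..M} - {i} \<Longrightarrow> f0 i j \<in> F j"
  shows "(\<integral>f. h f \<partial>sum_measure M F \<mu> \<nu> f0) =
    (\<Sum>i=1..M. \<nu> i * (\<integral>x. h (embed M f0 i x) \<partial>\<mu> i))"
proof -
  let ?N = "sum_measure M F \<mu> \<nu> f0" and ?F = "\<Pi>\<^sub>E i\<in>{1..M}. F i" and ?J = "embed M f0"
  have spN: "space ?N = ?F" and setsN: "sets ?N = Pow ?F"
    unfolding sum_measure_def by (auto simp: sigma_sets_top sigma_algebra.sigma_sets_eq[OF sigma_algebra_Pow])
  have J: "?J i x \<in> ?F" if "i \<in> {1..M}" "x \<in> F i" for i x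
    by (rule embed_mem[where F = F]) (use that f0 in auto)
  have "\<exists>A. finite A \<and> A \<subseteq> F i \<and> emeasure (\<mu> i) A = 1" if "i \<in> {1..M}" for i
    using \<mu>[OF that] by (simp add: fin_supp_prob_def)
  then obtain A where A: "\<And>i. i \<in> {1..M} \<Longrightarrow> finite (A i) \<and> A i \<subseteq> F i \<and> emeasure (\<mu> i) (A i) = 1"
    by metis
  \<comment> \<open>The common finite set of points that carries all the measures.\<close>
  define B where "B = (\<Union>i\<in>{1..M}. ?J i ` A i)"
  have B: "finite B" "B \<subseteq> ?F" unfolding B_def using A J by blast+
  have pr: "prob_space (\<mu> i)" and sp: "space (\<mu> i) = F i" and st: "sets (\<mu> i) = Pow (F i)"
    if "i \<in> {1..M}" for i using \<mu>[OF that] by (auto simp: fin_supp_prob_def)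
  have null: "emeasure (\<mu> i) (?J i -` (?F - B) \<inter> F i) = 0" if i: "i \<in> {1..M}" for i
  proof -
    interpret prob_space "\<mu> i" using pr[OF i] .
    have "emeasure (\<mu> i) (F i - A i) = 0"
      using A[OF i] sp[OF i] st[OF i] emeasure_compl[of "A i" "\<mu> i"] emeasure_space_1 by auto
    moreover have "?J i -` (?F - B) \<inter> F i \<subseteq> F i - A i" using i by (auto simp: B_def)
    ultimately show ?thesis using emeasure_mono[of _ "F i - A i" "\<mu> i"] st[OF i]
      by (metis Diff_subset PowI le_zero_eq)
  qed
  have fin: "emeasure (\<mu> i) C = ennreal (measure (\<mu> i) C)" if i: "i \<in> {1..M}" for i C
    using pr[OF i] by (simp add: finite_measure.emeasure_eq_measure prob_space_def)
  have emN: "emeasure ?N C = ennreal (\<Sum>i=1..M. \<nu> i * measure (\<mu> i) (?J i -` C \<inter> F i))"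
    if "C \<subseteq> ?F" for C
  proof -
    have "emeasure ?N C = (\<Sum>i=1..M. ennreal (\<nu> i) * emeasure (\<mu> i) (?J i -` C \<inter> F i))"
      by (rule emeasure_sum_measure[OF \<mu> that])
    also have "\<dots> = (\<Sum>i=1..M. ennreal (\<nu> i * measure (\<mu> i) (?J i -` C \<inter> F i)))"
      by (intro sum.cong) (simp_all add: fin \<nu> ennreal_mult)
    also have "\<dots> = ennreal (\<Sum>i=1..M. \<nu> i * measure (\<mu> i) (?J i -` C \<inter> F i))"
      by (rule sum_ennreal) (simp add: \<nu>)
    finally show ?thesis .
  qed
  have mN: "measure ?N C = (\<Sum>i=1..M. \<nu> i * measure (\<mu> i) (?J i -` C \<inter> F i))" if "C \<subseteq> ?F" for C
    unfolding measure_def[of ?N C] emN[OF that] by (intro enn2real_ennreal sum_nonneg mult_nonneg_nonneg \<nu>) auto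
  have "integral\<^sup>L ?N h = (\<Sum>b\<in>B. measure ?N {b} * h b)"
  proof (rule integral_finite_support)
    show "emeasure ?N (space ?N - B) = 0"
    proof -
      have "emeasure ?N (?F - B) =
          (\<Sum>i=1..M. ennreal (\<nu> i) * emeasure (\<mu> i) (?J i -` (?F - B) \<inter> F i))"
        by (rule emeasure_sum_measure[OF \<mu>]) auto
      also have "\<dots> = 0" by (intro sum.neutral ballI) (simp only: null mult_zero_right)
      finally show ?thesis by (simp only: spN)
    qed
    show "emeasure ?N {b} < \<infinity>" if "b \<in> B" for b
      using B that by (subst emN) auto
  qed (use B spN setsN in auto)
  also have "\<dots> = (\<Sum>b\<in>B. \<Sum>i=1..M. \<nu> i * (measure (\<mu> i) (?J i -` {b} \<inter> F i) * h b))"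
    using B by (intro sum.cong) (auto simp: mN sum_distrib_right mult.assoc subset_iff)
  also have "\<dots> = (\<Sum>i=1..M. \<nu> i * (\<Sum>b\<in>B. measure (\<mu> i) (?J i -` {b} \<inter> F i) * h b))"
    by (subst sum.swap) (simp add: sum_distrib_left)
  also have "\<dots> = (\<Sum>i=1..M. \<nu> i * (\<integral>x. h (?J i x) \<partial>\<mu> i))"
  proof (intro sum.cong refl arg_cong2[where f = "(*)"])
    fix i assume i: "i \<in> {1..M}"
    \<comment> \<open>Passing to the image measure moves the \<open>i\<close>-th integral onto the same finite set.\<close>
    let ?D = "distr (\<mu> i) (count_space ?F) (?J i)"
    have meas: "?J i \<in> measurable (\<mu> i) (count_space ?F)"
      using J[OF i] by (auto simp: measurable_def sp[OF i] st[OF i])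
    have emD: "emeasure ?D C = emeasure (\<mu> i) (?J i -` C \<inter> F i)" if "C \<subseteq> ?F" for C
      using that meas by (simp add: emeasure_distr sp[OF i])
    have "(\<integral>x. h (?J i x) \<partial>\<mu> i) = integral\<^sup>L ?D h"
      by (rule integral_distr[symmetric, OF meas]) simp
    also have "\<dots> = (\<Sum>b\<in>B. measure ?D {b} * h b)"
    proof (rule integral_finite_support)
      show "emeasure ?D (space ?D - B) = 0" 
        using null[OF i] emD[of "?F - B"] by (simp only: space_distr space_count_space Diff_subset)
      show "emeasure ?D {b} < \<infinity>" if "b \<in> B" for b
        using that B by (subst emD) (auto simp: fin[OF i])
    qed (use B in auto)
    also have "\<dots> = (\<Sum>b\<in>B. measure (\<mu> i) (?J i -` {b} \<inter> F i) * h b)"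
    proof (intro sum.cong refl)
      fix b assume "b \<in> B"
      then have "{b} \<subseteq> ?F" using B by blast
      then show "measure ?D {b} * h b = measure (\<mu> i) (?J i -` {b} \<inter> F i) * h b"
        by (simp only: measure_def emD)
    qed
    finally show "(\<Sum>b\<in>B. measure (\<mu> i) (?J i -` {b} \<inter> F i) * h b) = (\<integral>x. h (?J i x) \<partial>\<mu> i)" ..
  qed
  finally show ?thesis .
qed

lemma avg_non_error_le:
  assumes "set ls \<subseteq> infos P" "length ls \<le> n"
  shows "avg_non_error n P \<mu> \<le> (\<integral>f. norm (sol P f - alg_output ls \<phi> f) \<partial>\<mu>)"
  unfolding avg_non_error_def
proof (rule cInf_lower)
  show "bdd_below {\<integral>f. norm (sol P f - alg_output ls \<phi> f) \<partial>\<mu> | ls \<phi>. set ls \<subseteq> infos P \<and> length ls \<le> n}"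
    by (rule bdd_belowI[of _ 0]) auto
qed (use assms in blast)

lemma avg_non_error_greatest:
  assumes "\<And>ls \<phi>. set ls \<subseteq> infos P \<Longrightarrow> length ls \<le> n
    \<Longrightarrow> c \<le> (\<integral>f. norm (sol P f - alg_output ls \<phi> f) \<partial>\<mu>)"
  shows "c \<le> avg_non_error n P \<mu>"
  unfolding avg_non_error_def
proof (rule cInf_greatest)
  have "set [] \<subseteq> infos P \<and> length [] \<le> n" by simp
  then show "{\<integral>f. norm (sol P f - alg_output ls \<phi> f) \<partial>\<mu> | ls \<phi>. set ls \<subseteq> infos P \<and> length ls \<le> n} \<noteq> {}"
    by blast
qed (use assms in blast)

text \<open>
  The recombination map \<open>\<psi>\<close> exists because the values of \<open>ls'\<close> at \<open>x\<close> already determine those of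
  \<open>ls\<close> at \<open>J x\<close>: it evaluates the given algorithm at any input with the observed values.
\<close>

lemma alg_output_factor:
  assumes "\<And>l x y. l \<in> set ls \<Longrightarrow> x \<in> F \<Longrightarrow> y \<in> F \<Longrightarrow> (\<And>l'. l' \<in> set ls' \<Longrightarrow> l' x = l' y)
    \<Longrightarrow> l (J x) = l (J y)"
  obtains \<psi> where "\<And>x. x \<in> F \<Longrightarrow> alg_output ls \<phi> (J x) = alg_output ls' \<psi> x"
proof
  define r where "r vs = (SOME y. y \<in> F \<and> map (\<lambda>l. l y) ls' = vs)" for vs
  fix x assume x: "x \<in> F"
  let ?y = "r (map (\<lambda>l. l x) ls')"
  have "?y \<in> F \<and> map (\<lambda>l. l ?y) ls' = map (\<lambda>l. l x) ls'"
    unfolding r_def by (rule someI[of _ x]) (use x in simp)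
  then have "\<forall>l\<in>set ls. l (J x) = l (J ?y)" using assms x by (metis map_eq_conv)
  then have "map (\<lambda>l. l (J x)) ls = map (\<lambda>l. l (J ?y)) ls" by simp
  then show "alg_output ls \<phi> (J x) = alg_output ls' (\<lambda>vs. alg_output ls \<phi> (J (r vs))) x"
    unfolding alg_output_def by (rule arg_cong[where f = \<phi>])
qed

lemma sum_length_filter_fibres:
  assumes "finite I" "\<And>x. x \<in> set xs \<Longrightarrow> g x \<in> I"
  shows "(\<Sum>i\<in>I. length (filter (\<lambda>x. g x = i) xs)) = length xs"
  using assms(2)
proof (induction xs)
  case (Cons x xs)
  have "(\<Sum>i\<in>I. length (filter (\<lambda>x. g x = i) (x # xs))) =
      (\<Sum>i\<in>I. (if g x = i then 1 else 0) + length (filter (\<lambda>x. g x = i) xs))"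
    by (intro sum.cong) auto
  then show ?case using Cons assms(1) by (simp add: sum.distrib)
qed simp

lemma finite_budget_allocations:
  assumes "finite I"
  shows "finite {k \<in> I \<rightarrow>\<^sub>E (UNIV :: nat set). sum k I \<le> n}"
proof (rule finite_subset)
  show "{k \<in> I \<rightarrow>\<^sub>E (UNIV :: nat set). sum k I \<le> n} \<subseteq> I \<rightarrow>\<^sub>E {..n}"
  proof
    fix k :: "'a \<Rightarrow> nat"
    assume k: "k \<in> {k \<in> I \<rightarrow>\<^sub>E UNIV. sum k I \<le> n}"
    have "k i \<le> n" if "i \<in> I" for i
      using member_le_sum[of i I k] that assms k by simp
    then show "k \<in> I \<rightarrow>\<^sub>E {..n}" using k by (simp add: PiE_iff)
  qed
qed (simp add: assms finite_PiE)

theorem lemma2p1: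
  fixes M n :: nat
    and P :: "nat \<Rightarrow> ('f, 'k, 'g::banach) problem"
    and \<mu> :: "nat \<Rightarrow> 'f measure"
    and \<nu> :: "nat \<Rightarrow> real"
    and f0 :: "nat \<Rightarrow> nat \<Rightarrow> 'f"
  assumes "M \<ge> 1"
    and "\<And>i. i \<in> {1..M} \<Longrightarrow> numerical_problem (P i)"
    and "\<And>i l. i \<in> {1..M} \<Longrightarrow> l \<in> infos (P i) \<Longrightarrow> \<not> l constant_on inputs (P i)"
    and "\<And>i. i \<in> {1..M} \<Longrightarrow> fin_supp_prob (inputs (P i)) (\<mu> i)"
    and "\<And>i. i \<in> {1..M} \<Longrightarrow> \<nu> i \<ge> 0"
    and "(\<Sum>i=1..M. \<nu> i) = 1"
    and "\<And>i j. i \<in> {1..M} \<Longrightarrow> j \<in> {1..M} - {i} \<Longrightarrow> f0 i j \<in> inputs (P j)"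
    and "\<And>i. i \<in> {1..M} \<Longrightarrow> (\<Sum>j\<in>{1..M} - {i}. sol (P j) (f0 i j)) = 0"
  shows "avg_non_error n (sum_problem M P) (sum_measure M (\<lambda>i. inputs (P i)) \<mu> \<nu> f0)
    \<ge> Min {\<Sum>i=1..M. \<nu> i * avg_non_error (k i) (P i) (\<mu> i) | k :: nat \<Rightarrow> nat.
             k \<in> {1..M} \<rightarrow>\<^sub>E UNIV \<and> (\<Sum>i=1..M. k i) \<le> n}"
proof (rule avg_non_error_greatest)
  fix ls :: "((nat \<Rightarrow> 'f) \<Rightarrow> 'k) list" and \<phi> :: "'k list \<Rightarrow> 'g"
  assume ls: "set ls \<subseteq> infos (sum_problem M P)" and len: "length ls \<le> n"
  let ?J = "embed M f0" and ?E = "\<lambda>k. \<Sum>i=1..M. \<nu> i * avg_non_error (k i) (P i) (\<mu> i)"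
  have "\<exists>i l'. i \<in> {1..M} \<and> l' \<in> infos (P i) \<and> l = info_lift i l'" if "l \<in> set ls" for l
  proof -
    have "infos (sum_problem M P) = (\<Union>i\<in>{1..M}. info_lift i ` infos (P i))"
      unfolding sum_problem_def by (rule problem.simps)
    then show ?thesis using ls that by blast
  qed
  then obtain own base where own: "\<And>l. l \<in> set ls \<Longrightarrow> own l \<in> {1..M}"
    and base: "\<And>l. l \<in> set ls \<Longrightarrow> base l \<in> infos (P (own l))"
    and lift: "\<And>l. l \<in> set ls \<Longrightarrow> l = info_lift (own l) (base l)"
    by metis
  \<comment> \<open>Each functional is charged to the one problem \<open>own l\<close> from which it is lifted, so no unit of the
    budget \<open>n\<close> is spent twice.\<close>
  define ls' where "ls' i = map base (filter (\<lambda>l. own l = i) ls)" for i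
  define k where "k = (\<lambda>i\<in>{1..M}. length (ls' i))"
  have err: "avg_non_error (k i) (P i) (\<mu> i) \<le>
      (\<integral>x. norm (sol (sum_problem M P) (?J i x) - alg_output ls \<phi> (?J i x)) \<partial>\<mu> i)"
    if i: "i \<in> {1..M}" for i
  proof -
    have "l (?J i x) = l (?J i y)"
      if l: "l \<in> set ls" and eq: "\<And>l'. l' \<in> set (ls' i) \<Longrightarrow> l' x = l' y" for l x y
    proof -
      have "base l x = base l y" if "own l = i" by (rule eq) (use l that in \<open>auto simp: ls'_def\<close>)
      then have "info_lift (own l) (base l) (?J i x) = info_lift (own l) (base l) (?J i y)"
        using own[OF l] by (auto simp: info_lift_def embed_def)
      then show ?thesis using lift[OF l] by metis
    qed
    then obtain \<psi> where \<psi>: "\<And>x. x \<in> inputs (P i) \<Longrightarrow> alg_output ls \<phi> (?J i x) = alg_output (ls' i) \<psi> x"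
      by (rule alg_output_factor[where F = "inputs (P i)" and J = "?J i"]) blast+
    have sol: "sol (sum_problem M P) (?J i x) = sol (P i) x" for x
    proof -
      have "sol (sum_problem M P) (?J i x) =
          sol (P i) x + (\<Sum>j\<in>{1..M} - {i}. sol (P j) (?J i x j))"
        using i by (simp add: sum_problem_def sum.remove[where x = i] embed_def)
      also have "(\<Sum>j\<in>{1..M} - {i}. sol (P j) (?J i x j)) = (\<Sum>j\<in>{1..M} - {i}. sol (P j) (f0 i j))"
        by (intro sum.cong) (auto simp: embed_def)
      finally show ?thesis using assms(8)[OF i] by simp
    qed
    have "avg_non_error (k i) (P i) (\<mu> i) \<le> (\<integral>x. norm (sol (P i) x - alg_output (ls' i) \<psi> x) \<partial>\<mu> i)"
      by (rule avg_non_error_le) (use i base in \<open>auto simp: ls'_def k_def\<close>)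
    also have "\<dots> = (\<integral>x. norm (sol (sum_problem M P) (?J i x) - alg_output ls \<phi> (?J i x)) \<partial>\<mu> i)"
      by (rule Bochner_Integration.integral_cong)
        (use assms(4)[OF i] \<psi> in \<open>auto simp: sol fin_supp_prob_def\<close>)
    finally show ?thesis .
  qed
  have "(\<Sum>i=1..M. k i) = length ls"
    using sum_length_filter_fibres[of "{1..M}" ls own] own by (simp add: k_def ls'_def)
  then have kn: "(\<Sum>i=1..M. k i) \<le> n" using len by simp
  have "k \<in> {1..M} \<rightarrow>\<^sub>E UNIV" by (auto simp: k_def)
  then have "?E k \<in> ?E ` {k \<in> {1..M} \<rightarrow>\<^sub>E UNIV. (\<Sum>i=1..M. k i) \<le> n}"
    using kn by blast
  moreover have "finite (?E ` {k \<in> {1..M} \<rightarrow>\<^sub>E (UNIV :: nat set). (\<Sum>i=1..M. k i) \<le> n})"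
    by (intro finite_imageI finite_budget_allocations finite_atLeastAtMost)
  moreover have "{?E k | k :: nat \<Rightarrow> nat. k \<in> {1..M} \<rightarrow>\<^sub>E UNIV \<and> (\<Sum>i=1..M. k i) \<le> n} =
      ?E ` {k \<in> {1..M} \<rightarrow>\<^sub>E UNIV. (\<Sum>i=1..M. k i) \<le> n}" by blast
  ultimately have "Min {?E k | k :: nat \<Rightarrow> nat. k \<in> {1..M} \<rightarrow>\<^sub>E UNIV \<and> (\<Sum>i=1..M. k i) \<le> n} \<le> ?E k"
    by (simp only: Min_le)
  also have "\<dots> \<le> (\<Sum>i=1..M. \<nu> i *
      (\<integral>x. norm (sol (sum_problem M P) (?J i x) - alg_output ls \<phi> (?J i x)) \<partial>\<mu> i))"
    by (intro sum_mono mult_left_mono err assms(5)) auto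
  also have "\<dots> = (\<integral>f. norm (sol (sum_problem M P) f - alg_output ls \<phi> f)
      \<partial>sum_measure M (\<lambda>i. inputs (P i)) \<mu> \<nu> f0)"
    by (rule integral_sum_measure[symmetric]) (use assms(4,5,7) in auto)
  finally show "Min {?E k | k :: nat \<Rightarrow> nat. k \<in> {1..M} \<rightarrow>\<^sub>E UNIV \<and> (\<Sum>i=1..M. k i) \<le> n} \<le>
      (\<integral>f. norm (sol (sum_problem M P) f - alg_output ls \<phi> f)
        \<partial>sum_measure M (\<lambda>i. inputs (P i)) \<mu> \<nu> f0)" .
qed

end
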